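(* Let $(X,d)$ be a complete $\mathrm{CAT}(0)$ space satisfying the geodesic extension property. Then $(X,d)$ is locally compact if and only if both of the following hold: (1) $(X,d)$ satisfies the finite set property; (2) for every compact set $K\subseteq X$ the closure of its convex hull $\operatorname{cl}\operatorname{co}K$ is compact.
   Context: A $\mathrm{CAT}(0)$ space is a geodesic metric space in which every geodesic triangle is at least as thin as its Euclidean comparison triangle; such a space is uniquely geodesic, and $[x,y]$ denotes the geodesic segment joining $x$ and $y$. A set $C\subseteq X$ is convex if $[x,y]\subseteq C$ for all $x,y\in C$; $\operatorname{co}S$ denotes the smallest convex set containing $S$ and $\operatorname{cl}$ the closure. Geodesic extension property: for every geodesic $\gamma:[0,\ell]\to X$ there exist $\varepsilon>0$ and a geodesic $\widetilde\gamma:[0,\ell+\varepsilon]\to X$ with $\widetilde\gamma|_{[0,\ell]}=\gamma$; in a complete $\mathrm{CAT}(0)$ space this is understood as saying that every geodesic segment of positive length can be extended to a geodesic line $\mathbb R\to X$. Finite set property: for every $x\in X$ there exist an open set $U$ containing $x$ and a finite set $S\subseteq X$ such that $U\subseteq\operatorname{cl}\operatorname{co}S$. *)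

theory Defs
  imports "HOL-Analysis.Analysis"
begin

definition geodesic_on :: "real set \<Rightarrow> (real \<Rightarrow> 'a::metric_space) \<Rightarrow> bool" where
  "geodesic_on I \<gamma> \<longleftrightarrow> (\<forall>s\<in>I. \<forall>t\<in>I. dist (\<gamma> s) (\<gamma> t) = \<bar>s - t\<bar>)"

definition geodesic_segment :: "'a::metric_space \<Rightarrow> 'a \<Rightarrow> 'a set \<Rightarrow> bool" where
  "geodesic_segment x y A \<longleftrightarrow>
     (\<exists>\<gamma>. geodesic_on {0..dist x y} \<gamma> \<and> \<gamma> 0 = x \<and> \<gamma> (dist x y) = y \<and> A = \<gamma> ` {0..dist x y})"

definition geodesic_space :: "'a::metric_space itself \<Rightarrow> bool" where
  "geodesic_space _ \<longleftrightarrow> (\<forall>x y :: 'a. \<exists>A. geodesic_segment x y A)"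

text \<open>
  The pairs of a point \<open>u\<close> on a side \<open>A\<close> from \<open>x\<close> to \<open>y\<close> of a geodesic triangle and its comparison
  point \<open>u'\<close> on the corresponding side from \<open>x'\<close> to \<open>y'\<close> of a comparison triangle. Comparison
  points depend on the side: a point lying on two sides may have two of them.
\<close>

definition comparison_pairs ::
    "'a::metric_space \<Rightarrow> 'a \<Rightarrow> 'a set \<Rightarrow> real^2 \<Rightarrow> real^2 \<Rightarrow> ('a \<times> (real^2)) set" where
  "comparison_pairs x y A x' y' =
     {(u, u'). u \<in> A \<and> u' \<in> closed_segment x' y' \<and> dist x' u' = dist x u}"

definition CAT0_space :: "'a::metric_space itself \<Rightarrow> bool" where
  "CAT0_space T \<longleftrightarrow> geodesic_space T \<and>
     (\<forall>(p::'a) q r A B C (p'::real^2) q' r'.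
        geodesic_segment p q A \<and> geodesic_segment q r B \<and> geodesic_segment r p C \<and>
        dist p' q' = dist p q \<and> dist q' r' = dist q r \<and> dist r' p' = dist r p \<longrightarrow>
        (let P = comparison_pairs p q A p' q' \<union> comparison_pairs q r B q' r' \<union>
                 comparison_pairs r p C r' p'
         in \<forall>(u, u')\<in>P. \<forall>(v, v')\<in>P. dist u v \<le> dist u' v'))"

text \<open>
  In a CAT(0) space there is exactly one geodesic segment \<open>A\<close> from \<open>x\<close> to \<open>y\<close>, so the quantifier
  over \<open>A\<close> below just names the segment \<open>[x, y]\<close>.
\<close>

definition geodesically_convex :: "'a::metric_space set \<Rightarrow> bool" where
  "geodesically_convex C \<longleftrightarrow> (\<forall>x\<in>C. \<forall>y\<in>C. \<forall>A. geodesic_segment x y A \<longrightarrow> A \<subseteq> C)"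

abbreviation geodesic_hull :: "'a::metric_space set \<Rightarrow> 'a set" where
  "geodesic_hull S \<equiv> geodesically_convex hull S"

text \<open>
  The form of geodesic extension used for complete CAT(0) spaces: segments of positive length extend
  to geodesic lines. Since \<open>l = 0\<close> is excluded, a one-point space has the property.
\<close>

definition geodesic_extension_property :: "'a::metric_space itself \<Rightarrow> bool" where
  "geodesic_extension_property _ \<longleftrightarrow>
     (\<forall>l>0. \<forall>\<gamma> :: real \<Rightarrow> 'a. geodesic_on {0..l} \<gamma> \<longrightarrow>
        (\<exists>\<gamma>'. geodesic_on UNIV \<gamma>' \<and> (\<forall>t\<in>{0..l}. \<gamma>' t = \<gamma> t)))"

definition finite_set_property :: "'a::metric_space itself \<Rightarrow> bool" where
  "finite_set_property _ \<longleftrightarrow>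
     (\<forall>x::'a. \<exists>U S. open U \<and> x \<in> U \<and> finite S \<and> U \<subseteq> closure (geodesic_hull S))"

end

theory Submission
  imports Defs
begin

text \<open>
  The interesting part is that a locally compact space has the finite set property. By Hopf--Rinow
  closed balls are compact, so there is a finite set \<open>S\<close> that is a \<open>1/4\<close>-net of the unit ball around
  \<open>x\<close>. Its closed convex hull \<open>C\<close> already contains the ball of radius \<open>1/4\<close>: otherwise take a point
  \<open>y\<close> of that ball outside \<open>C\<close>, let \<open>p\<close> be a nearest point of \<open>C\<close>, and extend \<open>[p, y]\<close> beyond \<open>y\<close>
  to a segment \<open>[p, z]\<close> of length \<open>1/2\<close>. By the CAT(0) inequality \<open>p\<close> is also a nearest point of \<open>C\<close>
  to \<open>z\<close>, although \<open>z\<close> lies in the unit ball and hence within \<open>1/4\<close> of \<open>S\<close>.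
\<close>

section \<open>Comparison triangles in the Euclidean plane\<close>

lemma ex_comparison_triangle:
  fixes p q r :: "'a::metric_space"
  shows "\<exists>p' q' r' :: real^2. dist p' q' = dist p q \<and> dist q' r' = dist q r \<and> dist r' p' = dist r p"
proof -
  define a b c where "a = dist p q" and "b = dist q r" and "c = dist r p"
  have tri: "a \<le> b + c" "b \<le> a + c" "c \<le> a + b" and nn: "a \<ge> 0" "b \<ge> 0" "c \<ge> 0"
    unfolding a_def b_def c_def
    using dist_triangle[of p q r] dist_triangle[of q r p] dist_triangle[of r p q]
    by (simp_all add: dist_commute)
  \<comment> \<open>By the law of cosines, \<open>x\<close> is the abscissa of \<open>r'\<close>
    once \<open>p'\<close> is the origin and \<open>q'\<close> is \<open>(a, 0)\<close>. For
    \<open>a = 0\<close> division by zero gives \<open>x = 0\<close>, which is harmless because then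
    \<open>b = c\<close>.\<close>
  define x where "x = (a\<^sup>2 + c\<^sup>2 - b\<^sup>2) / (2 * a)"
  have ax: "2 * a * x = a\<^sup>2 + c\<^sup>2 - b\<^sup>2"
  proof (cases "a = 0")
    case True
    then have "b = c" using tri by simp
    with True show ?thesis by simp
  qed (simp add: x_def)
  \<comment> \<open>This bound makes the height of the triangle a real square root. For
    \<open>a > 0\<close> it says that \<open>b\<close> lies between \<open>\<bar>a - c\<bar>\<close>
    and \<open>a + c\<close>.\<close>
  have "\<bar>x\<bar> \<le> c"
  proof (cases "a = 0")
    case True
    then show ?thesis using nn by (simp add: x_def)
  next
    case False
    then have a: "a > 0" using nn by simp
    have "(a - c)\<^sup>2 \<le> b\<^sup>2" using tri nn by (intro abs_le_square_iff[THEN iffD1]) auto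
    then have "2 * a * x \<le> 2 * a * c" unfolding ax by (simp add: power2_diff)
    moreover have "b\<^sup>2 \<le> (a + c)\<^sup>2" using tri nn by (intro power_mono) auto
    then have "2 * a * (- c) \<le> 2 * a * x" unfolding ax by (simp add: power2_sum)
    ultimately have "x \<le> c" "- c \<le> x"
      using a by (metis mult_le_cancel_left_pos zero_less_mult_iff zero_less_numeral)+
    then show ?thesis by simp
  qed
  then have "x\<^sup>2 \<le> c\<^sup>2" by (metis abs_le_square_iff abs_of_nonneg nn(3))
  define p' q' r' :: "real^2" where "p' = 0" and "q' = vector [a, 0]"
    and "r' = vector [x, sqrt (c\<^sup>2 - x\<^sup>2)]"
  have "dist p' q' = a"
    using nn by (simp add: p'_def q'_def dist_norm norm_vec_def L2_set_def sum_2)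
  moreover have "dist r' p' = c"
    using nn \<open>x\<^sup>2 \<le> c\<^sup>2\<close> by (simp add: p'_def r'_def dist_norm norm_vec_def L2_set_def sum_2)
  moreover have "dist q' r' = sqrt ((a - x)\<^sup>2 + (c\<^sup>2 - x\<^sup>2))"
    using \<open>x\<^sup>2 \<le> c\<^sup>2\<close> by (simp add: q'_def r'_def dist_norm norm_vec_def L2_set_def sum_2)
  moreover have "(a - x)\<^sup>2 + (c\<^sup>2 - x\<^sup>2) = b\<^sup>2"
    using ax by (simp add: power2_diff)
  ultimately show ?thesis using nn unfolding a_def b_def c_def by (metis real_sqrt_abs abs_of_nonneg)
qed

section \<open>Points on geodesic segments\<close>

lemma geodesic_segment_commute:
  assumes "geodesic_segment x y A"
  shows "geodesic_segment y x A"
proof -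
  define d where "d = dist x y"
  obtain \<gamma> where \<gamma>: "geodesic_on {0..d} \<gamma>" "\<gamma> 0 = x" "\<gamma> d = y" "A = \<gamma> ` {0..d}"
    using assms unfolding geodesic_segment_def d_def by blast
  have "A = (\<lambda>t. \<gamma> (d - t)) ` {0..d}"
    unfolding \<gamma>(4)
  proof (intro equalityI subsetI)
    fix u assume "u \<in> \<gamma> ` {0..d}"
    then obtain t where "t \<in> {0..d}" "u = \<gamma> t" by blast
    then have "d - t \<in> {0..d}" "u = \<gamma> (d - (d - t))" by auto
    then show "u \<in> (\<lambda>t. \<gamma> (d - t)) ` {0..d}" by blast
  qed auto
  moreover have "geodesic_on {0..d} (\<lambda>t. \<gamma> (d - t))"
    using \<gamma>(1) by (auto simp: geodesic_on_def)
  moreover have "dist y x = d" by (simp add: d_def dist_commute)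
  ultimately show ?thesis
    unfolding geodesic_segment_def using \<gamma>(2,3) by (intro exI[of _ "\<lambda>t. \<gamma> (d - t)"]) auto
qed

lemma geodesic_segment_dist_add:
  assumes "geodesic_segment x y A" "u \<in> A"
  shows "dist x u + dist u y = dist x y"
proof -
  obtain \<gamma> t where \<gamma>: "geodesic_on {0..dist x y} \<gamma>" "\<gamma> 0 = x" "\<gamma> (dist x y) = y"
      and t: "t \<in> {0..dist x y}" "u = \<gamma> t"
    using assms unfolding geodesic_segment_def by blast
  have "dist (\<gamma> 0) (\<gamma> t) = t" "dist (\<gamma> t) (\<gamma> (dist x y)) = dist x y - t"
    using \<gamma>(1) t(1) by (simp_all add: geodesic_on_def)
  then show ?thesis using \<gamma>(2,3) t(2) by simp
qed

text \<open>Positions given as fractions of the length correspond to affine combinations in the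
  comparison triangle and can be matched between segments of different lengths.\<close>

lemma geodesic_segment_ex_fraction:
  assumes "geodesic_segment x y A" "0 \<le> s" "s \<le> 1"
  shows "\<exists>u\<in>A. dist x u = s * dist x y"
proof -
  obtain \<gamma> where \<gamma>: "geodesic_on {0..dist x y} \<gamma>" "\<gamma> 0 = x" "A = \<gamma> ` {0..dist x y}"
    using assms unfolding geodesic_segment_def by blast
  have t: "s * dist x y \<in> {0..dist x y}" using assms by (simp add: mult_left_le_one_le)
  then have "dist (\<gamma> 0) (\<gamma> (s * dist x y)) = s * dist x y"
    using \<gamma>(1) by (simp add: geodesic_on_def)
  with \<gamma> t show ?thesis by auto
qed

lemma geodesic_segment_fraction:
  assumes "geodesic_segment x y A" "u \<in> A"
  obtains s where "0 \<le> s" "s \<le> 1" "dist x u = s * dist x y"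
proof (cases "x = y")
  case True
  then have "dist x u = 0" using geodesic_segment_dist_add[OF assms] by (simp add: dist_commute)
  then show ?thesis using that[of 0] by simp
next
  case False
  moreover have "dist x u \<le> dist x y"
    using geodesic_segment_dist_add[OF assms] zero_le_dist[of u y] by linarith
  ultimately have "0 \<le> dist x u / dist x y" "dist x u / dist x y \<le> 1"
    "dist x u = dist x u / dist x y * dist x y"
    by (simp_all add: divide_le_eq_1)
  then show ?thesis using that by blast
qed

lemma geodesic_on_imp_segment:
  assumes "geodesic_on {0..l} \<gamma>" "0 \<le> l"
  shows "geodesic_segment (\<gamma> 0) (\<gamma> l) (\<gamma> ` {0..l})"
proof -
  have "dist (\<gamma> 0) (\<gamma> l) = l" using assms by (simp add: geodesic_on_def)
  then show ?thesis using assms unfolding geodesic_segment_def by auto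
qed

section \<open>Contraction, convexity and nearest points in CAT(0) spaces\<close>

lemma CAT0_ex_segment:
  assumes "CAT0_space TYPE('a::metric_space)"
  shows "\<exists>A. geodesic_segment (x::'a) y A"
  using assms by (simp add: CAT0_space_def geodesic_space_def)

lemma CAT0_comparison:
  fixes p q r :: "'a::metric_space" and p' q' r' :: "real^2"
  assumes "CAT0_space TYPE('a)"
    and "geodesic_segment p q A" "geodesic_segment q r B" "geodesic_segment r p C"
    and "dist p' q' = dist p q" "dist q' r' = dist q r" "dist r' p' = dist r p"
    and "(u, u') \<in> comparison_pairs p q A p' q' \<union> comparison_pairs q r B q' r' \<union>
                 comparison_pairs r p C r' p'"
    and "(v, v') \<in> comparison_pairs p q A p' q' \<union> comparison_pairs q r B q' r' \<union>
                 comparison_pairs r p C r' p'"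
  shows "dist u v \<le> dist u' v'"
proof -
  have "\<forall>(u, u')\<in>comparison_pairs p q A p' q' \<union> comparison_pairs q r B q' r' \<union>
                 comparison_pairs r p C r' p'.
        \<forall>(v, v')\<in>comparison_pairs p q A p' q' \<union> comparison_pairs q r B q' r' \<union>
                 comparison_pairs r p C r' p'. dist u v \<le> dist u' v'"
    using assms(1-7) unfolding CAT0_space_def Let_def by blast
  with assms(8,9) show ?thesis by blast
qed

text \<open>In the comparison triangle, the homothety with centre \<open>p'\<close> and ratio
  \<open>s\<close> takes \<open>q'\<close> and \<open>r'\<close> to the comparison points of
  \<open>u\<close> and \<open>v\<close>, so their distance is exactly
  \<open>s * dist q' r'\<close>.\<close>

lemma CAT0_contract:
  fixes p q r :: "'a::metric_space"
  assumes X: "CAT0_space TYPE('a)"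
    and A: "geodesic_segment p q A" "u \<in> A" "dist p u = s * dist p q"
    and C: "geodesic_segment p r C" "v \<in> C" "dist p v = s * dist p r"
    and s: "0 \<le> s" "s \<le> 1"
  shows "dist u v \<le> s * dist q r"
proof -
  obtain B where B: "geodesic_segment q r B" using CAT0_ex_segment[OF X] by blast
  obtain p' q' r' :: "real^2" where c: "dist p' q' = dist p q" "dist q' r' = dist q r"
      "dist r' p' = dist r p"
    using ex_comparison_triangle by blast
  define u' v' where "u' = (1 - s) *\<^sub>R p' + s *\<^sub>R q'" and "v' = (1 - s) *\<^sub>R p' + s *\<^sub>R r'"
  have "p' - u' = s *\<^sub>R (p' - q')" "r' - v' = (1 - s) *\<^sub>R (r' - p')" "u' - v' = s *\<^sub>R (q' - r')"
    by (simp_all add: u'_def v'_def algebra_simps)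
  then have d: "dist p' u' = s * dist p' q'" "dist r' v' = (1 - s) * dist r' p'"
      "dist u' v' = s * dist q' r'"
    using s by (simp_all add: dist_norm)
  have "u' \<in> closed_segment p' q'" using s by (auto simp: closed_segment_def u'_def)
  then have u: "(u, u') \<in> comparison_pairs p q A p' q'"
    using A d c by (simp add: comparison_pairs_def)
  have "v' \<in> closed_segment p' r'" using s by (auto simp: closed_segment_def v'_def)
  \<comment> \<open>The third side runs from \<open>r\<close> to \<open>p\<close>, and
    \<open>comparison_pairs\<close> measures from the first endpoint.\<close>
  moreover have "dist r v = (1 - s) * dist r p"
    using geodesic_segment_dist_add[OF C(1,2)] C(3) by (simp add: dist_commute algebra_simps)
  ultimately have "(v, v') \<in> comparison_pairs r p C r' p'"
    using C(2) d c by (simp add: comparison_pairs_def closed_segment_commute)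
  with u have "dist u v \<le> dist u' v'"
    using CAT0_comparison[OF X A(1) B geodesic_segment_commute[OF C(1)] c] by blast
  then show ?thesis using d c by simp
qed

text \<open>Euclidean balls are convex, so the comparison point of \<open>v\<close> stays within
  \<open>R\<close> of \<open>p'\<close>; comparison carries this bound back to
  \<open>v\<close>.\<close>

lemma CAT0_cball_convex:
  assumes X: "CAT0_space TYPE('a::metric_space)"
  shows "geodesically_convex (cball (p::'a) R)"
  unfolding geodesically_convex_def
proof (intro ballI allI impI subsetI)
  fix q r B v assume qr: "q \<in> cball p R" "r \<in> cball p R" and B: "geodesic_segment q r B" and v: "v \<in> B"
  obtain A where A: "geodesic_segment p q A" using CAT0_ex_segment[OF X] by blast
  obtain C where C: "geodesic_segment r p C" using CAT0_ex_segment[OF X] by blast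
  obtain p' q' r' :: "real^2" where c: "dist p' q' = dist p q" "dist q' r' = dist q r"
      "dist r' p' = dist r p"
    using ex_comparison_triangle by blast
  obtain s where s: "0 \<le> s" "s \<le> 1" "dist q v = s * dist q r"
    using geodesic_segment_fraction[OF B v] by blast
  define v' where "v' = (1 - s) *\<^sub>R q' + s *\<^sub>R r'"
  have v': "v' \<in> closed_segment q' r'" using s by (auto simp: closed_segment_def v'_def)
  have "q' - v' = s *\<^sub>R (q' - r')" by (simp add: v'_def algebra_simps)
  then have "dist q' v' = s * dist q' r'" using s by (simp add: dist_norm)
  then have "(v, v') \<in> comparison_pairs q r B q' r'"
    using v v' s c by (simp add: comparison_pairs_def)
  \<comment> \<open>The centre enters the comparison as a point of the side from \<open>p\<close> to
    \<open>q\<close>.\<close>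
  moreover have "p \<in> A" using geodesic_segment_ex_fraction[OF A, of 0] by auto
  then have "(p, p') \<in> comparison_pairs p q A p' q'" by (simp add: comparison_pairs_def)
  ultimately have "dist p v \<le> dist p' v'"
    using CAT0_comparison[OF X A B C c] by blast
  also have "closed_segment q' r' \<subseteq> cball p' R"
    using qr c by (intro closed_segment_subset) (auto simp: dist_commute)
  then have "dist p' v' \<le> R" using v' by auto
  finally show "v \<in> cball p R" by simp
qed

text \<open>Segments vary continuously with their endpoints: the point at fraction \<open>s\<close>
  of \<open>[x, y]\<close> is close to the one at fraction \<open>s\<close> of
  \<open>[x', y']\<close>. The endpoints are moved one at a time, passing through
  \<open>[x, y']\<close>.\<close>

lemma CAT0_closure_convex:
  assumes X: "CAT0_space TYPE('a::metric_space)" and H: "geodesically_convex (H::'a set)"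
  shows "geodesically_convex (closure H)"
  unfolding geodesically_convex_def
proof (intro ballI allI impI subsetI)
  fix x y A u assume xy: "x \<in> closure H" "y \<in> closure H"
    and A: "geodesic_segment x y A" and u: "u \<in> A"
  obtain s where s: "0 \<le> s" "s \<le> 1" "dist x u = s * dist x y"
    using geodesic_segment_fraction[OF A u] by blast
  show "u \<in> closure H"
    unfolding closure_approachable
  proof (intro allI impI)
    fix e :: real assume e: "e > 0"
    obtain x' where x': "x' \<in> H" "dist x' x < e / 2"
      using xy(1) e unfolding closure_approachable by (meson half_gt_zero)
    obtain y' where y': "y' \<in> H" "dist y' y < e / 2"
      using xy(2) e unfolding closure_approachable by (meson half_gt_zero)
    obtain B where B: "geodesic_segment x y' B" using CAT0_ex_segment[OF X] by blast
    obtain C where C: "geodesic_segment x' y' C" using CAT0_ex_segment[OF X] by blast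
    obtain v where v: "v \<in> B" "dist x v = s * dist x y'"
      using geodesic_segment_ex_fraction[OF B s(1,2)] by blast
    obtain w where w: "w \<in> C" "dist x' w = s * dist x' y'"
      using geodesic_segment_ex_fraction[OF C s(1,2)] by blast
    have "dist u v \<le> s * dist y y'"
      using CAT0_contract[OF X A u s(3) B v s(1,2)] .
    also have "\<dots> \<le> dist y y'" using s by (simp add: mult_left_le_one_le)
    finally have 1: "dist u v < e / 2" using y'(2) by (simp add: dist_commute)
    \<comment> \<open>The second move fixes \<open>y'\<close>, so the contraction is centred there
      and the fractions become \<open>1 - s\<close>.\<close>
    have "dist y' v = (1 - s) * dist y' x" "dist y' w = (1 - s) * dist y' x'"
      using geodesic_segment_dist_add[OF B v(1)] v(2) geodesic_segment_dist_add[OF C w(1)] w(2)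
      by (simp_all add: dist_commute algebra_simps)
    then have "dist v w \<le> (1 - s) * dist x x'"
      using s v w CAT0_contract[OF X geodesic_segment_commute[OF B] _ _ geodesic_segment_commute[OF C]]
      by simp
    also have "\<dots> \<le> dist x x'" using s by (simp add: mult_left_le_one_le)
    finally have 2: "dist v w < e / 2" using x'(2) by (simp add: dist_commute)
    have "dist w u < e"
      using 1 2 dist_triangle[of w u v] by (simp add: dist_commute)
    moreover have "w \<in> H" using H C w(1) x'(1) y'(1) unfolding geodesically_convex_def by blast
    ultimately show "\<exists>w\<in>H. dist w u < e" by blast
  qed
qed

lemma geodesically_convex_hull: "geodesically_convex (geodesic_hull S)"
  unfolding hull_def geodesically_convex_def by blast

lemma CAT0_closure_hull_subset_cball:
  assumes "CAT0_space TYPE('a::metric_space)" "S \<subseteq> cball (p::'a) R"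
  shows "closure (geodesic_hull S) \<subseteq> cball p R"
  by (intro closure_minimal hull_minimal assms CAT0_cball_convex) auto

text \<open>If \<open>y\<close> is at fraction \<open>s\<close> of \<open>[p, z]\<close>, the point
  \<open>v\<close> at fraction \<open>s\<close> of \<open>[p, c]\<close> lies in \<open>C\<close>. A
  point \<open>c\<close> closer to \<open>z\<close> than \<open>p\<close> would, by contraction
  towards \<open>p\<close>, make \<open>v\<close> closer to \<open>y\<close> than
  \<open>p\<close>.\<close>

lemma CAT0_nearest_point_extend:
  fixes p y z :: "'a::metric_space"
  assumes X: "CAT0_space TYPE('a)" and C: "geodesically_convex C" "p \<in> C"
    and near: "\<And>c. c \<in> C \<Longrightarrow> dist y p \<le> dist y c"
    and A: "geodesic_segment p z A" "y \<in> A" "y \<noteq> p"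
    and c: "c \<in> C"
  shows "dist z p \<le> dist z c"
proof -
  obtain s where s: "0 \<le> s" "s \<le> 1" "dist p y = s * dist p z"
    using geodesic_segment_fraction[OF A(1,2)] by blast
  obtain B where B: "geodesic_segment p c B" using CAT0_ex_segment[OF X] by blast
  obtain v where v: "v \<in> B" "dist p v = s * dist p c"
    using geodesic_segment_ex_fraction[OF B s(1,2)] by blast
  have "v \<in> C" using C B c v(1) unfolding geodesically_convex_def by blast
  then have "s * dist p z \<le> dist y v" using near s(3) by (metis dist_commute)
  also have "\<dots> \<le> s * dist z c" using CAT0_contract[OF X A(1,2) s(3) B v s(1,2)] .
  finally have "s * dist p z \<le> s * dist z c" .
  moreover have "s \<noteq> 0" using s(3) A(3) by auto
  then have "s > 0" using s(1) by simp
  ultimately show ?thesis by (simp add: dist_commute)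
qed

section \<open>Hopf-Rinow: compactness of closed balls\<close>

text \<open>Walking from \<open>x\<close> towards \<open>y\<close> and stopping at distance
  \<open>r\<close> leaves at most \<open>e\<close> to go. Hence balls of slightly larger radius are
  controlled by smaller ones.\<close>

lemma geodesic_space_ex_near:
  fixes x y :: "'a::metric_space"
  assumes G: "geodesic_space TYPE('a)" and "0 \<le> r" "0 \<le> e" "dist x y \<le> r + e"
  shows "\<exists>z. dist x z \<le> r \<and> dist z y \<le> e"
proof (cases "dist x y \<le> r")
  case True
  then show ?thesis using assms by (intro exI[of _ y]) auto
next
  case False
  then have pos: "dist x y > 0" using assms(2) by linarith
  obtain A where A: "geodesic_segment x y A" using G unfolding geodesic_space_def by blast
  have "0 \<le> r / dist x y" "r / dist x y \<le> 1"
    using False pos assms(2) by (simp_all add: divide_le_eq_1)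
  then obtain z where z: "z \<in> A" "dist x z = r / dist x y * dist x y"
    using geodesic_segment_ex_fraction[OF A] by blast
  then have "dist x z = r" using pos by simp
  moreover have "dist z y \<le> e"
    using geodesic_segment_dist_add[OF A z(1)] \<open>dist x z = r\<close> assms(4) by simp
  ultimately show ?thesis by auto
qed

lemma closed_subset_imp_compact:
  "compact (K::'a::topological_space set) \<Longrightarrow> closed C \<Longrightarrow> C \<subseteq> K \<Longrightarrow> compact C"
  by (metis compact_Int_closed inf.absorb2)

lemma compact_cball_le:
  "compact (cball (x::'a::metric_space) R) \<Longrightarrow> r \<le> R \<Longrightarrow> compact (cball x r)"
  by (rule closed_subset_imp_compact[OF _ closed_cball]) auto

text \<open>Finitely many open sets with compact supersets cover the ball, and they also cover a
  uniform neighbourhood of it by compactness.\<close>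

lemma compact_cball_extend:
  fixes x :: "'a::metric_space"
  assumes G: "geodesic_space TYPE('a)" and L: "locally_compact_space (euclidean :: 'a topology)"
    and R: "0 \<le> R" "compact (cball x R)"
  shows "\<exists>e>0. compact (cball x (R + e))"
proof -
  have "\<forall>y::'a. \<exists>U K. open U \<and> compact K \<and> y \<in> U \<and> U \<subseteq> K"
    using L by (simp add: locally_compact_space_def)
  then obtain U K where UK: "\<And>y::'a. open (U y) \<and> compact (K y) \<and> y \<in> U y \<and> U y \<subseteq> K y"
    by metis
  have "cball x R \<subseteq> (\<Union>y\<in>cball x R. U y)" using UK by blast
  then obtain F where F: "finite F" "cball x R \<subseteq> (\<Union>y\<in>F. U y)"
    using compactE_image[OF R(2), of "cball x R" U] UK by metis
  have "open (\<Union>y\<in>F. U y)" using UK by blast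
  then obtain e where e: "e > 0" "(\<Union>z\<in>cball x R. ball z e) \<subseteq> (\<Union>y\<in>F. U y)"
    using compact_subset_open_imp_ball_epsilon_subset[OF R(2) _ F(2)] by blast
  \<comment> \<open>Halving \<open>e\<close> turns the bound \<open>\<le> e / 2\<close> into
    membership in the open ball of radius \<open>e\<close>.\<close>
  have "cball x (R + e / 2) \<subseteq> (\<Union>y\<in>F. K y)"
  proof
    fix y assume "y \<in> cball x (R + e / 2)"
    then obtain z where "dist x z \<le> R" "dist z y \<le> e / 2"
      using geodesic_space_ex_near[OF G R(1), of "e / 2" x y] e(1) by auto
    then have "y \<in> (\<Union>z\<in>cball x R. ball z e)" using e(1) by (intro UN_I[of z]) auto
    then show "y \<in> (\<Union>y\<in>F. K y)" using e(2) UK by blast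
  qed
  moreover have "compact (\<Union>y\<in>F. K y)" using F(1) UK by (intro compact_UN) auto
  ultimately have "compact (cball x (R + e / 2))"
    using closed_subset_imp_compact[OF _ closed_cball] by blast
  then show ?thesis using e(1) by (intro exI[of _ "e / 2"]) simp
qed

text \<open>A finite \<open>e / 2\<close>-net of a ball whose radius is smaller by at most
  \<open>e / 2\<close> is an \<open>e\<close>-net of the whole ball; completeness then gives
  compactness.\<close>

lemma compact_cball_limit:
  fixes x :: "'a::complete_space"
  assumes G: "geodesic_space TYPE('a)" and "0 < R"
    and c: "\<And>r. 0 \<le> r \<Longrightarrow> r < R \<Longrightarrow> compact (cball x r)"
  shows "compact (cball x R)"
  unfolding compact_eq_totally_bounded
proof (intro conjI allI impI)
  show "complete (cball x R)" by (simp add: complete_eq_closed)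
  fix e :: real assume e: "e > 0"
  \<comment> \<open>The maximum keeps the radius nonnegative when \<open>e > 2 * R\<close>.\<close>
  define r where "r = max 0 (R - e / 2)"
  have r: "0 \<le> r" "r < R" "R \<le> r + e / 2" using e \<open>0 < R\<close> by (auto simp: r_def)
  then obtain k where k: "finite k" "cball x r \<subseteq> (\<Union>z\<in>k. ball z (e / 2))"
    using c[OF r(1,2)] e unfolding compact_eq_totally_bounded by (meson half_gt_zero)
  have "cball x R \<subseteq> (\<Union>z\<in>k. ball z e)"
  proof
    fix y assume "y \<in> cball x R"
    then obtain z where z: "dist x z \<le> r" "dist z y \<le> e / 2"
      using geodesic_space_ex_near[OF G r(1), of "e / 2" x y] e r(3) by auto
    then obtain w where w: "w \<in> k" "dist w z < e / 2" using k(2) by auto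
    then have "dist w y < e" using z(2) dist_triangle[of w y z] by simp
    with w(1) show "y \<in> (\<Union>z\<in>k. ball z e)" by auto
  qed
  with k(1) show "\<exists>k. finite k \<and> cball x R \<subseteq> (\<Union>z\<in>k. ball z e)" by blast
qed

text \<open>If some ball were not compact, the radii of compact balls would have a finite supremum
  \<open>M\<close>. The limit lemma makes the ball of radius \<open>M\<close> compact, and the
  extension lemma then exceeds \<open>M\<close>.\<close>

theorem Hopf_Rinow_compact_cball:
  fixes x :: "'a::complete_space"
  assumes G: "geodesic_space TYPE('a)" and L: "locally_compact_space (euclidean :: 'a topology)"
  shows "compact (cball x R)"
proof (rule ccontr)
  assume nc: "\<not> compact (cball x R)"
  define T where "T = {r. 0 \<le> r \<and> compact (cball x r)}"
  have T0: "0 \<in> T" by (simp add: T_def)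
  have lt: "r < R" if "r \<in> T" for r
    using that nc compact_cball_le[of x r R] by (force simp: T_def)
  then have bdd: "bdd_above T" by (intro bdd_aboveI[of _ R]) force
  define M where "M = Sup T"
  \<comment> \<open>Extending the one-point ball of radius \<open>0\<close> gives
    \<open>M > 0\<close>, as the limit lemma requires.\<close>
  obtain e where e: "e > 0" "compact (cball x (0 + e))"
    using compact_cball_extend[OF G L, of 0 x] by auto
  then have "e \<in> T" by (simp add: T_def)
  then have "M > 0" using e(1) cSup_upper[OF _ bdd] unfolding M_def by fastforce
  have "compact (cball x r)" if "r < M" for r
    using that less_cSup_iff[OF _ bdd, of r] T0 compact_cball_le[of x]
    unfolding M_def by (force simp: T_def)
  then have "compact (cball x M)" using compact_cball_limit[OF G \<open>M > 0\<close>] by blast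
  then obtain e where e: "e > 0" "compact (cball x (M + e))"
    using compact_cball_extend[OF G L, of M x] \<open>M > 0\<close> by auto
  then have "M + e \<in> T" using \<open>M > 0\<close> by (simp add: T_def)
  then show False using e(1) cSup_upper[OF _ bdd] unfolding M_def by fastforce
qed

section \<open>The finite set property and the equivalence\<close>

lemma proper_CAT0_finite_set_property:
  assumes X: "CAT0_space TYPE('a::metric_space)" and E: "geodesic_extension_property TYPE('a)"
    and P: "\<And>(x::'a) R. compact (cball x R)"
  shows "finite_set_property TYPE('a)"
  unfolding finite_set_property_def
proof
  fix x :: 'a
  have "cball x 1 \<subseteq> (\<Union>y\<in>cball x 1. ball y (1 / 4))" by force
  then obtain S where S: "finite S" "S \<subseteq> cball x 1" "cball x 1 \<subseteq> (\<Union>y\<in>S. ball y (1 / 4))"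
    using compactE_image[OF P[of x 1], of "cball x 1" "\<lambda>y. ball y (1 / 4)"] by (metis open_ball)
  define C where "C = closure (geodesic_hull S)"
  have SC: "S \<subseteq> C" unfolding C_def by (rule order_trans[OF hull_subset closure_subset])
  have conv: "geodesically_convex C"
    unfolding C_def by (intro CAT0_closure_convex X geodesically_convex_hull)
  have "C \<subseteq> cball x 1" unfolding C_def by (rule CAT0_closure_hull_subset_cball[OF X S(2)])
  then have "compact C" using closed_subset_imp_compact[OF P[of x 1]] by (simp add: C_def)
  have "x \<in> (\<Union>y\<in>S. ball y (1 / 4))" by (rule subsetD[OF S(3)]) simp
  then have "C \<noteq> {}" using SC by blast
  have "ball x (1 / 4) \<subseteq> C"
  proof
    fix y assume y: "y \<in> ball x (1 / 4)"
    show "y \<in> C"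
    proof (rule ccontr)
      assume "y \<notin> C"
      obtain p where p: "p \<in> C" "\<And>c. c \<in> C \<Longrightarrow> dist y p \<le> dist y c"
        using continuous_attains_inf[OF \<open>compact C\<close> \<open>C \<noteq> {}\<close>, of "dist y"]
          continuous_on_dist[OF continuous_on_const continuous_on_id, of C y]
        by auto
      have "y \<noteq> p" using p(1) \<open>y \<notin> C\<close> by blast
      then have l: "dist p y > 0" by simp
      \<comment> \<open>Since \<open>y\<close> is in the unit ball, the net bounds
        \<open>dist y p\<close> by \<open>1/4\<close>; thus \<open>y\<close> comes before parameter
        \<open>1/2\<close> on the line \<open>\<beta>\<close>.\<close>
      obtain c where "c \<in> S" "dist c y < 1 / 4" using S(3) y by force
      then have yp: "dist y p < 1 / 4" using p(2)[of c] SC by (force simp: dist_commute)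
      obtain A \<gamma> where \<gamma>: "geodesic_on {0..dist p y} \<gamma>" "\<gamma> 0 = p" "\<gamma> (dist p y) = y"
        using CAT0_ex_segment[OF X, of p y] unfolding geodesic_segment_def by blast
      obtain \<beta> where \<beta>: "geodesic_on UNIV \<beta>" "\<forall>t\<in>{0..dist p y}. \<beta> t = \<gamma> t"
        using E l \<gamma>(1) unfolding geodesic_extension_property_def by blast
      have \<beta>py: "\<beta> 0 = p" "\<beta> (dist p y) = y" using \<beta>(2) \<gamma> by auto
      \<comment> \<open>The parameter \<open>1/2\<close> exceeds the mesh \<open>1/4\<close>, yet
        \<open>1/4 + 1/4 + 1/2 = 1\<close> keeps \<open>z\<close> in the unit ball around
        \<open>x\<close>.\<close>
      define z where "z = \<beta> (1 / 2)"
      have "geodesic_on {0..1/2} \<beta>" using \<beta>(1) by (simp add: geodesic_on_def)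
      then have "geodesic_segment p z (\<beta> ` {0..1/2})"
        using geodesic_on_imp_segment[of "1/2" \<beta>] by (simp add: z_def \<beta>py)
      moreover have "y \<in> \<beta> ` {0..1/2}"
        using yp \<beta>py by (intro image_eqI[of _ _ "dist p y"]) (auto simp: dist_commute)
      ultimately have near: "dist z p \<le> dist z c" if "c \<in> C" for c
        using CAT0_nearest_point_extend[OF X conv p _ _ \<open>y \<noteq> p\<close> that] by blast
      have zp: "dist z p = 1 / 2" using \<beta>(1) \<beta>py by (force simp: geodesic_on_def z_def)
      have "dist x z \<le> dist x y + dist y p + dist z p"
        using dist_triangle[of x z y] dist_triangle[of y z p] by (simp add: dist_commute)
      then have "z \<in> cball x 1" using y yp zp by simp
      then obtain c where "c \<in> S" "dist c z < 1 / 4" using S(3) by force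
      then show False using near[of c] SC zp by (force simp: dist_commute)
    qed
  qed
  then show "\<exists>U S. open U \<and> x \<in> U \<and> finite S \<and> U \<subseteq> closure (geodesic_hull S)"
    using S(1) unfolding C_def by (intro exI[of _ "ball x (1 / 4)"] exI[of _ S]) auto
qed

theorem theorem2:
  assumes "CAT0_space TYPE('a::complete_space)"
    and "geodesic_extension_property TYPE('a)"
  shows "locally_compact_space (euclidean :: 'a topology) \<longleftrightarrow>
    finite_set_property TYPE('a) \<and>
    (\<forall>K :: 'a set. compact K \<longrightarrow> compact (closure (geodesic_hull K)))"
proof (intro iffI conjI allI impI)
  assume L: "locally_compact_space (euclidean :: 'a topology)"
  have P: "compact (cball (x::'a) R)" for x R
    using Hopf_Rinow_compact_cball[OF _ L] assms(1) by (simp add: CAT0_space_def)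
  show "finite_set_property TYPE('a)"
    by (rule proper_CAT0_finite_set_property[OF assms P])
  fix K :: "'a set" assume "compact K"
  then obtain x R where "K \<subseteq> cball x R"
    using compact_imp_bounded bounded_subset_cball by blast
  then have "closure (geodesic_hull K) \<subseteq> cball x R"
    by (rule CAT0_closure_hull_subset_cball[OF assms(1)])
  then show "compact (closure (geodesic_hull K))"
    using closed_subset_imp_compact[OF P closed_closure] by blast
next
  \<comment> \<open>The finite set \<open>S\<close> is compact, so
    \<open>closure (geodesic_hull S)\<close> is a compact set containing the open set
    \<open>U\<close> around the given point.\<close>
  assume "finite_set_property TYPE('a) \<and>
    (\<forall>K :: 'a set. compact K \<longrightarrow> compact (closure (geodesic_hull K)))"
  then show "locally_compact_space (euclidean :: 'a topology)"
    unfolding locally_compact_space_def finite_set_property_def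
    by simp (metis finite_imp_compact)
qed

end
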